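(* Let $p\in(0,\infty)$, let $x\in\Sigma$, and let $\Phi_2,\Psi_2:\mathbb N\to(0,\infty)$ be the functions associated with $p$ and $x$. Then the following hold. (i) There are $b_1,b_2>0$ such that, for all $n\in\mathbb N$, $$b_1\Phi_2(n)\le\frac1n\left(\sum_{k=1}^n\frac1{f^{k-1}(x)^p}\right)\le b_2\Psi_2(n).$$ (ii) The following statements (a), (b), (c) and (d) are equivalent. (a) The block decomposition of $x$ is regular. (b) There is $a>0$ such that $\Psi_2(n)\le a\,\Phi_2(n)$ for all $n\in\mathbb N$. (c) There are $b_1,b_2>0$ such that, for all $n\in\mathbb N$, $$b_1\Phi_2(n)\le\frac1n\left(\sum_{k=1}^n\frac1{f^{k-1}(x)^p}\right)\le b_2\Phi_2(n).$$ (d) There are $c_1,c_2>0$ such that, for all $n\in\mathbb N$, $$c_1\Psi_2(n)\le\frac1n\left(\sum_{k=1}^n\frac1{f^{k-1}(x)^p}\right)\le c_2\Psi_2(n).$$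
   Context: $\mathbb N=\{1,2,3,\dots\}$. The map $f:[0,1)\to[0,1)$ is $f(x)=2x$ if $0\le x<1/2$ and $f(x)=2x-1$ if $1/2\le x<1$; $f^k$ is the $k$-fold composition, $f^0(x)=x$. $\Sigma$ is the set of $x\in[0,1)$ that are not binary rationals (a binary rational is $0$ or a number $k/2^n$ with $k,n\in\mathbb N$, $1\le k<2^n$). Each $x\in\Sigma$ has a unique binary expansion $x=\sum_{k\ge1}d_k/2^k$, $d_k\in\{0,1\}$, and its digits are neither eventually all $0$ nor eventually all $1$. Block decomposition: for $x\in\Sigma$ the digit sequence $d_1d_2d_3\dots$ is written uniquely as juxtaposed finite blocks $C_0B_1C_1B_2C_2\cdots$, where each $B_j$ ($j\ge1$) is a non-empty block of zeros, each $C_j$ ($j\ge1$) is a non-empty block of ones, and $C_0$ is a (possibly empty) block of ones. Let $\ell_j\ge1$ be the length of $B_j$ ($j\ge1$) and $m_j$ the length of $C_j$ ($j\ge0$), so $m_j\ge1$ for $j\ge1$ and $m_0\ge0$. Let $J_j\subset\mathbb N$ be the set of positions occupied by $B_j$ and $K_j$ the set of positions occupied by $C_j$: with $s_0=0$, $t_0=m_0$, $s_j=t_{j-1}+\ell_j$, $t_j=s_j+m_j$ for $j\ge1$, one has $J_j=\{t_{j-1}+1,\dots,s_j\}$ for $j\ge 1$ and $K_j=\{s_j+1,\dots,t_j\}$ for $j\ge0$ ($K_0=\emptyset$ if $C_0$ is empty). The sets $K_0,J_1,K_1,J_2,K_2,\dots$ partition $\mathbb N$. Definition of $\Phi_1,\Psi_1$: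 if $n\in K_0\cup J_1\cup K_1$, $\Phi_1(n)=\Psi_1(n)=1$. If $n\in J_j$ with $j\ge2$, $\Phi_1(n)=\Psi_1(n)=\sum_{u=1}^j2^{p\ell_u}+\sum_{u=1}^{j-1}m_u$. If $n\in K_j$ with $j\ge2$, $\Phi_1(n)=\sum_{u=1}^j2^{p\ell_u}+\sum_{u=1}^{j-1}m_u$ and $\Psi_1(n)=\sum_{u=1}^j2^{p\ell_u}+\sum_{u=1}^{j}m_u$. Definition of $\Phi_2,\Psi_2$: if $n\in K_0\cup J_1\cup K_1$, $\Phi_2(n)=\Psi_2(n)=1$. If $n\in J_j$ with $j\ge2$, $$\Phi_2(n)=\frac{\Phi_1(n)}{\sum_{u=1}^j\ell_u+\sum_{u=1}^{j-1}m_u},\qquad \Psi_2(n)=\frac{\Psi_1(n)}{\sum_{u=1}^{j-1}\ell_u+\sum_{u=1}^{j-1}m_u}.$$ If $n\in K_j$ with $j\ge2$, $$\Phi_2(n)=\frac{\Phi_1(n)}{\sum_{u=1}^j\ell_u+\sum_{u=1}^{j}m_u},\qquad \Psi_2(n)=\frac{\Psi_1(n)}{\sum_{u=1}^{j}\ell_u+\sum_{u=1}^{j-1}m_u}.$$ The block decomposition of $x\in\Sigma$ is called regular if there is $C>0$ such that for all $j\ge2$, $$\max\left(\frac{\ell_j}{\sum_{u=1}^{j-1}\ell_u+\sum_{u=1}^{j-1}m_u},\ \frac{m_j}{\sum_{u=1}^{j}\ell_u+\sum_{u=1}^{j-1}m_u}\right)\le C.$$ *)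

theory Defs
  imports Complex_Main
begin

definition doubling :: "real \<Rightarrow> real" where
  "doubling x = (if x < 1/2 then 2 * x else 2 * x - 1)"

definition binary_rational :: "real \<Rightarrow> bool" where
  "binary_rational x \<longleftrightarrow>
     x = 0 \<or> (\<exists>k n::nat. 1 \<le> n \<and> 1 \<le> k \<and> k < 2 ^ n \<and> x = real k / 2 ^ n)"

definition nondyadic :: "real set" where
  "nondyadic = {x. 0 \<le> x \<and> x < 1 \<and> \<not> binary_rational x}"

(* Digits and blocks are numbered from 1, apart from the initial block of ones, which has
   number 0.  The unused values d 0 and l 0 are set to 0 so that the objects are unique. *)

definition binary_expansion :: "real \<Rightarrow> (nat \<Rightarrow> nat) \<Rightarrow> bool" where
  "binary_expansion x d \<longleftrightarrow>
     d 0 = 0 \<and> (\<forall>k\<ge>1. d k \<in> {0, 1}) \<and> (\<lambda>k. real (d (Suc k)) / 2 ^ Suc k) sums x"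

definition digits :: "real \<Rightarrow> nat \<Rightarrow> nat" where
  "digits x = (THE d. binary_expansion x d)"

(* l j and m j are the lengths of the j-th block of zeros and of the j-th block of ones;
   tpos l m j and spos l m j are the last positions of these blocks. *)

primrec tpos :: "(nat \<Rightarrow> nat) \<Rightarrow> (nat \<Rightarrow> nat) \<Rightarrow> nat \<Rightarrow> nat" where
  "tpos l m 0 = m 0"
| "tpos l m (Suc j) = tpos l m j + l (Suc j) + m (Suc j)"

definition spos :: "(nat \<Rightarrow> nat) \<Rightarrow> (nat \<Rightarrow> nat) \<Rightarrow> nat \<Rightarrow> nat" where
  "spos l m j = (if j = 0 then 0 else tpos l m (j - 1) + l j)"

definition zero_block :: "(nat \<Rightarrow> nat) \<Rightarrow> (nat \<Rightarrow> nat) \<Rightarrow> nat \<Rightarrow> nat set" where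
  "zero_block l m j = (if j = 0 then {} else {tpos l m (j - 1) + 1 .. spos l m j})"

definition one_block :: "(nat \<Rightarrow> nat) \<Rightarrow> (nat \<Rightarrow> nat) \<Rightarrow> nat \<Rightarrow> nat set" where
  "one_block l m j = {spos l m j + 1 .. tpos l m j}"

definition block_decomposition ::
    "(nat \<Rightarrow> nat) \<Rightarrow> (nat \<Rightarrow> nat) \<Rightarrow> (nat \<Rightarrow> nat) \<Rightarrow> bool" where
  "block_decomposition d l m \<longleftrightarrow>
     l 0 = 0 \<and> (\<forall>j\<ge>1. l j \<ge> 1 \<and> m j \<ge> 1) \<and>
     (\<forall>j\<ge>1. \<forall>n\<in>zero_block l m j. d n = 0) \<and>
     (\<forall>j. \<forall>n\<in>one_block l m j. d n = 1)"

definition block_lengths :: "real \<Rightarrow> (nat \<Rightarrow> nat) \<times> (nat \<Rightarrow> nat)" where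
  "block_lengths x = (THE lm. block_decomposition (digits x) (fst lm) (snd lm))"

definition ell :: "real \<Rightarrow> nat \<Rightarrow> nat" where
  "ell x = fst (block_lengths x)"

definition em :: "real \<Rightarrow> nat \<Rightarrow> nat" where
  "em x = snd (block_lengths x)"

definition Jpos :: "real \<Rightarrow> nat \<Rightarrow> nat set" where
  "Jpos x j = zero_block (ell x) (em x) j"

definition Kpos :: "real \<Rightarrow> nat \<Rightarrow> nat set" where
  "Kpos x j = one_block (ell x) (em x) j"

definition block_index :: "real \<Rightarrow> nat \<Rightarrow> nat" where
  "block_index x n = (THE j. n \<in> Jpos x j \<union> Kpos x j)"

(* Every n >= 1 lies in exactly one of the sets Jpos x j, Kpos x j (block_index_unique), so the
   innermost else branches below are the case n in Kpos x j with j >= 2. *)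

definition Phi1 :: "real \<Rightarrow> real \<Rightarrow> nat \<Rightarrow> real" where
  "Phi1 p x n =
     (if n \<in> Kpos x 0 \<union> Jpos x 1 \<union> Kpos x 1 then 1
      else let j = block_index x n in
        (\<Sum>u=1..j. 2 powr (p * real (ell x u))) + (\<Sum>u=1..j-1. real (em x u)))"

definition Psi1 :: "real \<Rightarrow> real \<Rightarrow> nat \<Rightarrow> real" where
  "Psi1 p x n =
     (if n \<in> Kpos x 0 \<union> Jpos x 1 \<union> Kpos x 1 then 1
      else let j = block_index x n in
        if n \<in> Jpos x j
        then (\<Sum>u=1..j. 2 powr (p * real (ell x u))) + (\<Sum>u=1..j-1. real (em x u))
        else (\<Sum>u=1..j. 2 powr (p * real (ell x u))) + (\<Sum>u=1..j. real (em x u)))"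

definition Phi2 :: "real \<Rightarrow> real \<Rightarrow> nat \<Rightarrow> real" where
  "Phi2 p x n =
     (if n \<in> Kpos x 0 \<union> Jpos x 1 \<union> Kpos x 1 then 1
      else let j = block_index x n in
        if n \<in> Jpos x j
        then Phi1 p x n / ((\<Sum>u=1..j. real (ell x u)) + (\<Sum>u=1..j-1. real (em x u)))
        else Phi1 p x n / ((\<Sum>u=1..j. real (ell x u)) + (\<Sum>u=1..j. real (em x u))))"

definition Psi2 :: "real \<Rightarrow> real \<Rightarrow> nat \<Rightarrow> real" where
  "Psi2 p x n =
     (if n \<in> Kpos x 0 \<union> Jpos x 1 \<union> Kpos x 1 then 1
      else let j = block_index x n in
        if n \<in> Jpos x j
        then Psi1 p x n / ((\<Sum>u=1..j-1. real (ell x u)) + (\<Sum>u=1..j-1. real (em x u)))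
        else Psi1 p x n / ((\<Sum>u=1..j. real (ell x u)) + (\<Sum>u=1..j-1. real (em x u))))"

definition regular_decomposition :: "real \<Rightarrow> bool" where
  "regular_decomposition x \<longleftrightarrow>
     (\<exists>C>0. \<forall>j\<ge>2.
        max (real (ell x j) / ((\<Sum>u=1..j-1. real (ell x u)) + (\<Sum>u=1..j-1. real (em x u))))
            (real (em x j) / ((\<Sum>u=1..j. real (ell x u)) + (\<Sum>u=1..j-1. real (em x u))))
        \<le> C)"

definition birkhoff_average :: "real \<Rightarrow> real \<Rightarrow> nat \<Rightarrow> real" where
  "birkhoff_average p x n =
     1 / real n * (\<Sum>k=1..n. 1 / ((doubling ^^ (k - 1)) x) powr p)"

(* The definite descriptions above are well defined for x in nondyadic. *)

lemma expansion_floor: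
  assumes x: "x \<in> nondyadic" and d: "binary_expansion x d"
  shows "of_int \<lfloor>2 ^ n * x\<rfloor> = 2 ^ n * (\<Sum>k<n. real (d (Suc k)) / 2 ^ Suc k)"
    and "\<exists>k>n. d k = 0" and "\<exists>k>n. d k = 1"
proof -
  let ?g = "\<lambda>k. real (d (Suc k)) / 2 ^ Suc k"
  let ?N = "\<Sum>k<n. d (Suc k) * 2 ^ (n - Suc k)"
  have d01: "\<And>k. d (Suc k) = 0 \<or> d (Suc k) = 1" and s: "?g sums x"
    using d by (auto simp: binary_expansion_def)
  have N: "2 ^ n * sum ?g {..<n} = real ?N"
  proof -
    have "2 ^ n * ?g k = real (d (Suc k) * 2 ^ (n - Suc k))" if "k < n" for k
    proof -
      have "(2::real) ^ n = 2 ^ Suc k * 2 ^ (n - Suc k)"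
        using that by (metis Suc_leI le_add_diff_inverse power_add)
      then show ?thesis by simp
    qed
    then show ?thesis by (simp add: sum_distrib_left)
  qed
  have tail: "(\<lambda>k. ?g (k + n)) sums (x - sum ?g {..<n})"
    using sums_split_initial_segment[OF s] by simp
  have tl': "(\<lambda>k. 2 ^ n * ?g (k + n)) sums (2 ^ n * (x - sum ?g {..<n}))"
    by (rule sums_mult[OF tail])
  have eq: "2 ^ n * ?g (k + n) = real (d (Suc (k + n))) * (1/2) ^ Suc k" for k
    by (simp add: power_add power_one_over field_simps)
  have T: "(\<lambda>k. real (d (Suc (k + n))) * (1/2) ^ Suc k) sums (2 ^ n * x - real ?N)"
    using tl' unfolding eq right_diff_distrib N .
  have x01: "0 \<le> x" "x < 1" "\<not> binary_rational x" using x by (auto simp: nondyadic_def)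
  have nobin: "2 ^ n * x \<noteq> real M" for M :: nat
  proof
    assume M: "2 ^ n * x = real M"
    then have xM: "x = real M / 2 ^ n" by (simp add: field_simps)
    have "x \<noteq> 0" using x01 by (auto simp: binary_rational_def)
    then have "M \<ge> 1" using xM by (cases M) auto
    have "2 ^ n * x < 2 ^ n * 1" using x01(2) by (intro mult_strict_left_mono) auto
    then have "real M < 2 ^ n" using M by simp
    then have M2: "M < 2 ^ n" by (metis of_nat_less_numeral_power_cancel_iff)
    have "n \<ge> 1" using M2 \<open>M \<ge> 1\<close> by (cases n) auto
    then show False using x01(3) M2 \<open>M \<ge> 1\<close> xM unfolding binary_rational_def by blast
  qed
  have ub: "2 ^ n * x - real ?N \<le> 1"
  proof (rule sums_le[OF _ T power_half_series])
    show "real (d (Suc (k + n))) * (1/2) ^ Suc k \<le> (1/2) ^ Suc k" for k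
      using d01[of "k + n"] by auto
  qed
  have lb: "0 \<le> 2 ^ n * x - real ?N"
    by (rule sums_le[OF _ sums_zero T]) auto
  have "2 ^ n * x \<noteq> real (?N + 1)" by (rule nobin)
  then have lt: "2 ^ n * x - real ?N < 1" using ub by simp
  have "of_int (int ?N) \<le> 2 ^ n * x" "2 ^ n * x < of_int (int ?N) + 1"
    using lt lb unfolding of_int_of_nat_eq by auto
  then have "\<lfloor>2 ^ n * x\<rfloor> = int ?N" by (rule floor_unique)
  then show "of_int \<lfloor>2 ^ n * x\<rfloor> = 2 ^ n * sum ?g {..<n}" by (simp only: N of_int_of_nat_eq)
  show "\<exists>k>n. d k = 0"
  proof (rule ccontr)
    assume "\<not> (\<exists>k>n. d k = 0)"
    then have "d (Suc (k + n)) = 1" for k using d01[of "k + n"] by (metis le_add2 less_Suc_eq_le)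
    then have "(\<lambda>k. (1/2) ^ Suc k) sums (2 ^ n * x - real ?N)" using T by simp
    then show False using sums_unique2[OF power_half_series] lt by fastforce
  qed
  show "\<exists>k>n. d k = 1"
  proof (rule ccontr)
    assume "\<not> (\<exists>k>n. d k = 1)"
    then have "d (Suc (k + n)) = 0" for k using d01[of "k + n"] by (metis le_add2 less_Suc_eq_le)
    then have "(\<lambda>k. 0) sums (2 ^ n * x - real ?N)" using T by simp
    then show False using sums_unique2[OF sums_zero] nobin[of ?N] by fastforce
  qed
qed

lemma expansion_unique:
  assumes x: "x \<in> nondyadic" and d: "binary_expansion x d" and e: "binary_expansion x e"
  shows "d = e"
proof
  fix k
  show "d k = e k"
  proof (cases k)
    case 0
    then show ?thesis using d e by (simp add: binary_expansion_def)
  next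
    case (Suc n)
    have *: "(\<Sum>k<n. real (d (Suc k)) / 2 ^ Suc k) = (\<Sum>k<n. real (e (Suc k)) / 2 ^ Suc k)" for n
      using expansion_floor(1)[OF x d, of n] expansion_floor(1)[OF x e, of n] by simp
    show ?thesis using *[of n] *[of "Suc n"] Suc by simp
  qed
qed

lemma expansion_exists:
  assumes x: "x \<in> nondyadic"
  shows "\<exists>d. binary_expansion x d"
proof -
  have x01: "0 \<le> x" "x < 1" using x by (auto simp: nondyadic_def)
  define d where "d k = (if k = 0 then 0 else nat (\<lfloor>2 ^ k * x\<rfloor> mod 2))" for k :: nat
  have step: "real (d (Suc n)) = of_int \<lfloor>2 ^ Suc n * x\<rfloor> - 2 * of_int \<lfloor>2 ^ n * x\<rfloor>" for n
  proof -
    have "\<lfloor>2 ^ Suc n * x\<rfloor> div 2 = \<lfloor>2 ^ n * x\<rfloor>"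
      using floor_divide_real_eq_div[of 2 "2 ^ Suc n * x"] by simp
    then have "int (d (Suc n)) = \<lfloor>2 ^ Suc n * x\<rfloor> - 2 * \<lfloor>2 ^ n * x\<rfloor>"
      unfolding d_def by (simp add: minus_div_mult_eq_mod [symmetric])
    then have "of_int (int (d (Suc n))) = (of_int (\<lfloor>2 ^ Suc n * x\<rfloor> - 2 * \<lfloor>2 ^ n * x\<rfloor>) :: real)"
      by (simp only:)
    then show ?thesis by simp
  qed
  have ps: "(\<Sum>k<n. real (d (Suc k)) / 2 ^ Suc k) = of_int \<lfloor>2 ^ n * x\<rfloor> / 2 ^ n" for n
  proof (induction n)
    case 0
    have "\<lfloor>x\<rfloor> = 0" using x01 by (simp add: floor_eq_iff)
    then show ?case by simp
  next
    case (Suc n)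
    then show ?case by (simp only: sum.lessThan_Suc step) (simp add: field_simps)
  qed
  have lim: "(\<lambda>n. of_int \<lfloor>2 ^ n * x\<rfloor> / 2 ^ n) \<longlonglongrightarrow> x"
  proof (rule real_tendsto_sandwich)
    show "\<forall>\<^sub>F n in sequentially. x - (1/2) ^ n \<le> of_int \<lfloor>2 ^ n * x\<rfloor> / 2 ^ n"
    proof (intro always_eventually allI)
      fix n
      have "2 ^ n * x - 1 \<le> of_int \<lfloor>2 ^ n * x\<rfloor>" by linarith
      then have "(2 ^ n * x - 1) / 2 ^ n \<le> of_int \<lfloor>2 ^ n * x\<rfloor> / 2 ^ n"
        by (intro divide_right_mono) auto
      then show "x - (1/2) ^ n \<le> of_int \<lfloor>2 ^ n * x\<rfloor> / 2 ^ n"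
        by (simp add: diff_divide_distrib power_one_over)
    qed
    show "\<forall>\<^sub>F n in sequentially. of_int \<lfloor>2 ^ n * x\<rfloor> / 2 ^ n \<le> x"
    proof (intro always_eventually allI)
      fix n
      have "of_int \<lfloor>2 ^ n * x\<rfloor> \<le> 2 ^ n * x" by linarith
      then show "of_int \<lfloor>2 ^ n * x\<rfloor> / 2 ^ n \<le> x" by (simp add: field_simps)
    qed
    have "(\<lambda>n. x - (1/2) ^ n) \<longlonglongrightarrow> x - 0"
      by (intro tendsto_intros LIMSEQ_power_zero) auto
    then show "(\<lambda>n. x - (1/2) ^ n) \<longlonglongrightarrow> x" by simp
  qed simp
  have "binary_expansion x d"
    unfolding binary_expansion_def sums_def ps using lim by (auto simp: d_def)
  then show ?thesis by (rule exI[of _ d])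
qed

lemma binary_expansion_digits:
  assumes "x \<in> nondyadic"
  shows "binary_expansion x (digits x)"
proof -
  have "\<exists>!d. binary_expansion x d"
    using expansion_exists[OF assms] expansion_unique[OF assms] by blast
  from theI'[OF this] show ?thesis by (simp add: digits_def)
qed

lemma decomposition_exists:
  assumes d01: "\<And>k. k \<ge> 1 \<Longrightarrow> d k \<in> {0, 1}"
    and z: "\<And>n. \<exists>k>n. d k = 0" and o: "\<And>n. \<exists>k>n. d k = (1::nat)"
  shows "\<exists>l m. block_decomposition d l m"
proof -
  define nxt where "nxt b n = (LEAST k. d (n + k + 1) = b)" for b n :: nat
  have ex: "\<exists>k. d (n + k + 1) = b" if "b \<in> {0, 1}" for n b
  proof -
    have "\<exists>k>n. d k = b" using that z[of n] o[of n] by auto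
    then obtain k where "k > n" "d k = b" by blast
    then show ?thesis by (intro exI[of _ "k - n - 1"]) auto
  qed
  have nx: "d (n + nxt b n + 1) = b" if "b \<in> {0, 1}" for n b
    unfolding nxt_def by (rule LeastI_ex[OF ex[OF that]])
  have nb: "d i \<noteq> b" if "n + 1 \<le> i" "i \<le> n + nxt b n" for n b i
  proof -
    have "i - n - 1 < nxt b n" using that by auto
    from not_less_Least[OF this[unfolded nxt_def]] show ?thesis using that by simp
  qed
  define T where "T = rec_nat (nxt 0 0)
    (\<lambda>_ t. t + nxt 1 t + nxt 0 (t + nxt 1 t))"
  have T0: "T 0 = nxt 0 0" and TS: "\<And>j. T (Suc j) = T j + nxt 1 (T j) + nxt 0 (T j + nxt 1 (T j))"
    by (auto simp: T_def)
  define l where "l j = (if j = 0 then 0 else nxt 1 (T (j - 1)))" for j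
  define m where "m j = (if j = 0 then nxt 0 0 else nxt 0 (T (j - 1) + l j))" for j
  have tp: "tpos l m j = T j" for j
    by (induction j) (auto simp: T0 TS m_def l_def)
  have dT: "d (T j + 1) = 0" for j
    by (cases j) (use nx[of 0] nx[of 0 0] in \<open>auto simp: T0 TS\<close>)
  have l1: "l (Suc j) \<ge> 1" for j
    using nx[of 1 "T j"] dT[of j] by (cases "l (Suc j)") (auto simp: l_def)
  have ds: "d (T j + l (Suc j) + 1) = 1" for j
    using nx[of 1 "T j"] by (simp add: l_def)
  have m1: "m (Suc j) \<ge> 1" for j
    using nx[of 0 "T j + l (Suc j)"] ds[of j] by (cases "m (Suc j)") (auto simp: m_def)
  have Z: "d n = 0" if nj: "n \<in> zero_block l m j" for n j
  proof -
    obtain i where j: "j = Suc i" using nj by (cases j) (auto simp: zero_block_def)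
    have "d n \<noteq> 1" using that nb[of "T i" n 1] by (auto simp: j zero_block_def spos_def tp l_def)
    then show ?thesis using d01[of n] that by (auto simp: j zero_block_def)
  qed
  have O: "d n = 1" if "n \<in> one_block l m j" for n j
  proof -
    have "d n \<noteq> 0" using that nb[of "spos l m j" n 0]
      by (cases j) (auto simp: one_block_def spos_def tp T0 TS l_def m_def)
    then show ?thesis using d01[of n] that by (auto simp: one_block_def)
  qed
  have "\<forall>j\<ge>1. l j \<ge> 1 \<and> m j \<ge> 1"
    using l1 m1 by (metis One_nat_def Suc_le_D)
  then have "block_decomposition d l m"
    unfolding block_decomposition_def using Z O by (auto simp: l_def)
  then show ?thesis by blast
qed

lemma decomposition_le:
  assumes A: "block_decomposition d l m" and B: "block_decomposition d l' m'"
  shows "m 0 \<le> m' 0"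
    and "tpos l m j = tpos l' m' j \<Longrightarrow> l (Suc j) \<le> l' (Suc j)"
    and "spos l m (Suc j) = spos l' m' (Suc j) \<Longrightarrow> m (Suc j) \<le> m' (Suc j)"
proof -
  have zA: "d n = 0" if "tpos l m j < n" "n \<le> spos l m (Suc j)" for n j
    using A that by (auto simp: block_decomposition_def zero_block_def dest: spec[of _ "Suc j"])
  have oA: "d n = 1" if "spos l m j < n" "n \<le> tpos l m j" for n j
    using A that by (auto simp: block_decomposition_def one_block_def dest: spec[of _ j])
  have zB: "d n = 0" if "tpos l' m' j < n" "n \<le> spos l' m' (Suc j)" for n j
    using B that by (auto simp: block_decomposition_def zero_block_def dest: spec[of _ "Suc j"])
  have oB: "d n = 1" if "spos l' m' j < n" "n \<le> tpos l' m' j" for n j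
    using B that by (auto simp: block_decomposition_def one_block_def dest: spec[of _ j])
  have pos: "l' (Suc j) \<ge> 1" "m' (Suc j) \<ge> 1" for j
    using B by (auto simp: block_decomposition_def)
  show "m 0 \<le> m' 0"
    using oA[of 0 "m' 0 + 1"] zB[of 0 "m' 0 + 1"] pos(1)[of 0] by (force simp: spos_def)
  show "l (Suc j) \<le> l' (Suc j)" if "tpos l m j = tpos l' m' j"
    using zA[of j "spos l' m' (Suc j) + 1"] oB[of "Suc j" "spos l' m' (Suc j) + 1"] pos[of j] that
    by (force simp: spos_def)
  show "m (Suc j) \<le> m' (Suc j)" if "spos l m (Suc j) = spos l' m' (Suc j)"
    using oA[of "Suc j" "tpos l' m' (Suc j) + 1"] zB[of "Suc j" "tpos l' m' (Suc j) + 1"]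
      pos(1)[of "Suc j"] that
    by (force simp: spos_def)
qed

lemma decomposition_unique:
  assumes A: "block_decomposition d l m" and B: "block_decomposition d l' m'"
  shows "l = l' \<and> m = m'"
proof -
  note le = decomposition_le[OF A B] decomposition_le[OF B A]
  have l: "l (Suc j) = l' (Suc j)" if "tpos l m j = tpos l' m' j" for j
    using le(2)[of j] le(5)[of j] that by simp
  have m: "m (Suc j) = m' (Suc j)" if "tpos l m j = tpos l' m' j" for j
    using le(3)[of j] le(6)[of j] that l[of j] by (simp add: spos_def)
  have t: "tpos l m j = tpos l' m' j" for j
    by (induction j) (use le(1,4) l m in auto)
  have "l j = l' j" for j
    using A B l t by (cases j) (auto simp: block_decomposition_def)
  moreover have "m j = m' j" for j
    using le(1,4) m t by (cases j) auto
  ultimately show ?thesis by auto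
qed

lemma block_decomposition_digits:
  assumes x: "x \<in> nondyadic"
  shows "block_decomposition (digits x) (ell x) (em x)"
proof -
  have e: "binary_expansion x (digits x)" by (rule binary_expansion_digits[OF x])
  have "\<exists>l m. block_decomposition (digits x) l m"
    by (rule decomposition_exists)
      (use e expansion_floor(2,3)[OF x e] in \<open>auto simp: binary_expansion_def\<close>)
  then have "\<exists>!lm. block_decomposition (digits x) (fst lm) (snd lm)"
    using decomposition_unique by (metis fst_conv prod.expand snd_conv)
  from theI'[OF this] show ?thesis by (simp add: block_lengths_def ell_def em_def)
qed

lemma block_index_unique:
  assumes x: "x \<in> nondyadic" and n: "n \<ge> 1"
  shows "\<exists>!j. n \<in> Jpos x j \<union> Kpos x j"
proof -
  let ?t = "tpos (ell x) (em x)"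
  have B: "ell x (Suc j) \<ge> 1" "em x (Suc j) \<ge> 1" for j
    using block_decomposition_digits[OF x] by (auto simp: block_decomposition_def)
  have mono: "?t i \<le> ?t j" if "i \<le> j" for i j
    using that by (induction rule: dec_induct) auto
  have ge: "j \<le> ?t j" for j
  proof (induction j)
    case (Suc j)
    then show ?case using B(1)[of j] by simp
  qed simp
  have mem: "n \<in> Jpos x j \<union> Kpos x j \<longleftrightarrow> n \<le> ?t j \<and> (\<forall>i<j. ?t i < n)" for j
  proof (cases j)
    case 0
    then show ?thesis using n by (auto simp: Jpos_def Kpos_def zero_block_def one_block_def spos_def)
  next
    case (Suc i)
    have "(\<forall>k<j. ?t k < n) \<longleftrightarrow> ?t i < n"
      using mono Suc by (metis less_Suc_eq_le le_less_trans lessI)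
    then show ?thesis
      by (auto simp: Suc Jpos_def Kpos_def zero_block_def one_block_def spos_def)
  qed
  have "n \<le> ?t (LEAST j. n \<le> ?t j) \<and> (\<forall>i<(LEAST j. n \<le> ?t j). ?t i < n)"
    using LeastI[of "\<lambda>j. n \<le> ?t j", OF ge] not_less_Least[of _ "\<lambda>j. n \<le> ?t j"]
    by (auto simp: not_le)
  then have "\<exists>j. n \<in> Jpos x j \<union> Kpos x j" using mem by blast
  moreover have "i = j" if "n \<in> Jpos x i \<union> Kpos x i" "n \<in> Jpos x j \<union> Kpos x j" for i j
    using that unfolding mem by (metis linorder_neqE_nat not_le)
  ultimately show ?thesis by blast
qed

end

theory Submission imports Defs
begin

text \<open>
  Write \<open>q = 2 powr p\<close>. A digit \<open>1\<close> at position \<open>k\<close> puts the orbit point in \<open>[1/2, 1)\<close>, so the \<open>k\<close>-th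
  summand lies between \<open>1\<close> and \<open>q\<close>, while at a digit \<open>0\<close> the \<open>k\<close>-th summand is \<open>q\<close> times its
  successor. Hence the sum over a block of \<open>r\<close> zeros is geometric, of order \<open>q ^ r\<close>, and dominated
  by the first position of the block; the sum over a block of ones is of the order of its length.
  This gives (i). Since \<open>Psi2 / Phi2\<close> on the \<open>j\<close>-th blocks is governed by the two quotients in the
  definition of regularity, regularity is equivalent to (b). For (c) and (d) the averages are
  tested at the first and at the last position of each block.
\<close>

text \<open>Cross multiplication, in the form in which the quotients \<open>Psi2\<close> and
  \<open>Phi2\<close> are compared.\<close>

lemma divide_le_scaled:
  fixes y z d d' k :: real
  assumes "y * d' \<le> k * z * d" "d > 0" "d' > 0"
  shows "y / d \<le> k * (z / d')"
  using assms by (simp add: field_simps)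

section \<open>Orbit, partial sums, and the numerators and denominators of \<open>Phi2\<close> and
  \<open>Psi2\<close>\<close>

locale doubling_orbit =
  fixes p x :: real
  assumes p_pos: "p > 0" and x_nondyadic: "x \<in> nondyadic"
begin

abbreviation "l \<equiv> ell x"
abbreviation "m \<equiv> em x"
abbreviation "s \<equiv> spos l m"
abbreviation "t \<equiv> tpos l m"

declare tpos.simps(2) [simp del]

definition q :: real where "q = 2 powr p"

definition orbit :: "nat \<Rightarrow> real" where "orbit n = (doubling ^^ n) x"

definition a :: "nat \<Rightarrow> real" where "a k = 1 / orbit (k - 1) powr p"

definition S :: "nat \<Rightarrow> real" where "S n = (\<Sum>k=1..n. a k)"

text \<open>For \<open>j \<ge> 1\<close>, \<open>F j\<close> and \<open>D j\<close> are the end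
  positions \<open>t j\<close> and \<open>s j\<close> with the length \<open>m 0\<close> of the
  initial block of ones removed. They serve as denominators, \<open>P j\<close> and
  \<open>Q j\<close> as numerators.\<close>

definition F :: "nat \<Rightarrow> real" where
  "F j = (\<Sum>u=1..j. real (l u)) + (\<Sum>u=1..j. real (m u))"

definition D :: "nat \<Rightarrow> real" where
  "D j = (\<Sum>u=1..j. real (l u)) + (\<Sum>u=1..j-1. real (m u))"

definition P :: "nat \<Rightarrow> real" where
  "P j = (\<Sum>u=1..j. 2 powr (p * real (l u))) + (\<Sum>u=1..j-1. real (m u))"

definition Q :: "nat \<Rightarrow> real" where
  "Q j = (\<Sum>u=1..j. 2 powr (p * real (l u))) + (\<Sum>u=1..j. real (m u))"

lemma q_gt_1: "q > 1"
  using p_pos by (simp add: q_def)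

lemma powr_q: "2 powr (p * real n) = q ^ n"
  unfolding q_def by (simp add: powr_powr[symmetric] powr_realpow)

lemma blocks: "block_decomposition (digits x) l m"
  by (rule block_decomposition_digits[OF x_nondyadic])

lemma lengths_pos: "j \<ge> 1 \<Longrightarrow> l j \<ge> 1" "j \<ge> 1 \<Longrightarrow> m j \<ge> 1"
  using blocks by (auto simp: block_decomposition_def)

lemma digit_J: "n \<in> Jpos x j \<Longrightarrow> digits x n = 0"
  using blocks by (cases "j \<ge> 1") (auto simp: block_decomposition_def Jpos_def zero_block_def simp del: One_nat_def)

lemma digit_K: "n \<in> Kpos x j \<Longrightarrow> digits x n = 1"
  using blocks by (auto simp: block_decomposition_def Kpos_def)

lemma t_Suc: "t (Suc j) = s (Suc j) + m (Suc j)"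
  and s_Suc: "s (Suc j) = t j + l (Suc j)"
  by (simp_all add: spos_def tpos.simps(2))

lemma mem_J: "n \<in> Jpos x (Suc j) \<longleftrightarrow> t j < n \<and> n \<le> s (Suc j)"
  by (auto simp: Jpos_def zero_block_def)

lemma mem_K: "n \<in> Kpos x j \<longleftrightarrow> s j < n \<and> n \<le> t j"
  by (auto simp: Kpos_def one_block_def)

section \<open>Orbit points and the size of single summands\<close>

lemma orbit_frac: "orbit n = frac (2 ^ n * x)"
proof (induction n)
  case 0
  then show ?case using x_nondyadic by (simp add: orbit_def nondyadic_def frac_eq)
next
  case (Suc n)
  \<comment> \<open>\<open>doubling (frac y)\<close> lies in [0, 1) and differs from
    \<open>2 * y\<close> by an integer, which characterises the fractional part.\<close>
  have "doubling (frac y) = frac (2 * y)" for y :: real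
    using frac_unique_iff[of "2 * y" "doubling (frac y)"] frac_ge_0[of y] frac_lt_1[of y]
    by (auto simp: doubling_def frac_def)
  then show ?case using Suc by (simp add: orbit_def mult.assoc)
qed

text \<open>The floor of \<open>2 ^ n * x\<close> is \<open>2 ^ n\<close> times a partial sum of the
  expansion, so \<open>orbit n\<close> is the rescaled tail; doubling it releases one more
  digit.\<close>

lemma orbit_Suc: "orbit (Suc n) = 2 * orbit n - real (digits x (Suc n))"
proof -
  note fl = expansion_floor(1)[OF x_nondyadic binary_expansion_digits[OF x_nondyadic]]
  show ?thesis
    unfolding orbit_frac frac_def fl sum.lessThan_Suc by (simp add: field_simps)
qed

lemma orbit_bounds: "0 \<le> orbit n" "orbit n < 1"
  by (simp_all add: orbit_frac frac_lt_1)

lemma a_one: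
  assumes "n \<in> Kpos x j"
  shows "1 \<le> a n" "a n \<le> q"
proof -
  obtain k where n: "n = Suc k" using assms by (cases n) (auto simp: mem_K)
  \<comment> \<open>With digit 1 the next orbit point is \<open>2 * orbit k - 1\<close>, and it is
    nonnegative. Position \<open>n\<close> belongs to the orbit index \<open>n - 1\<close>.\<close>
  have o: "1 / 2 \<le> orbit k" "orbit k < 1"
    using orbit_Suc[of k] orbit_bounds[of "Suc k"] orbit_bounds[of k] digit_K[OF assms]
    by (auto simp: n)
  have "orbit k powr p \<le> 1 powr p" "(1 / 2) powr p \<le> orbit k powr p"
    by (intro powr_mono2; use o p_pos in simp)+
  moreover have "(1 / 2) powr p = 1 / q" by (simp add: q_def powr_divide)
  ultimately have "1 / q \<le> orbit k powr p" "orbit k powr p \<le> 1" by simp_all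
  then show "1 \<le> a n" "a n \<le> q"
    using q_gt_1 o by (simp_all add: a_def n field_simps)
qed

lemma a_zero:
  assumes "n \<in> Jpos x j"
  shows "a n = q * a (Suc n)"
proof -
  obtain k where n: "n = Suc k" using assms by (cases n; cases j) (auto simp: Jpos_def zero_block_def)
  have "orbit n = 2 * orbit k"
    using orbit_Suc[of k] digit_J[OF assms] by (simp add: n)
  then have "orbit n powr p = q * orbit k powr p"
    using orbit_bounds[of k] by (simp add: powr_mult q_def)
  then show ?thesis using q_gt_1 by (simp add: a_def n)
qed

text \<open>Here \<open>r\<close> counts backwards from the first one after the block of zeros;
  \<open>r = 0\<close> is that one itself and \<open>r = l (Suc j)\<close> the first zero of the
  block.\<close>

lemma a_zero_run:
  assumes "r \<le> l (Suc j)"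
  shows "a (s (Suc j) + 1 - r) = q ^ r * a (s (Suc j) + 1)"
  using assms
proof (induction r)
  case (Suc r)
  have "s (Suc j) + 1 - Suc r \<in> Jpos x (Suc j)"
    using Suc.prems by (auto simp: mem_J s_Suc)
  from a_zero[OF this] show ?case
    using Suc by (simp add: s_Suc Suc_diff_le algebra_simps)
qed simp

lemma first_one: "s (Suc j) + 1 \<in> Kpos x (Suc j)"
  using lengths_pos(2)[of "Suc j"] by (simp add: mem_K t_Suc)

lemma a_zero_run_bounds:
  assumes "r \<le> l (Suc j)"
  shows "q ^ r \<le> a (s (Suc j) + 1 - r)" "a (s (Suc j) + 1 - r) \<le> q * q ^ r"
  using a_zero_run[OF assms] a_one[OF first_one, of j] q_gt_1 by simp_all

lemma in_blocks: "n \<ge> 1 \<Longrightarrow> \<exists>j. n \<in> Jpos x j \<union> Kpos x j"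
  using block_index_unique[OF x_nondyadic, of n] by blast

lemma a_ge_1:
  assumes "n \<ge> 1"
  shows "a n \<ge> 1"
proof -
  obtain j where "n \<in> Jpos x j \<union> Kpos x j" using in_blocks[OF assms] by blast
  then show ?thesis
  proof
    assume n: "n \<in> Jpos x j"
    then obtain i where j: "j = Suc i" by (cases j) (auto simp: Jpos_def zero_block_def)
    define r where "r = s (Suc i) + 1 - n"
    have "r \<le> l (Suc i)" "n = s (Suc i) + 1 - r"
      using n by (auto simp: j mem_J r_def s_Suc)
    then have "q ^ r \<le> a n" using a_zero_run_bounds(1) by simp
    moreover have "1 \<le> q ^ r" using q_gt_1 by (simp add: one_le_power)
    ultimately show ?thesis by simp
  qed (use a_one in blast)
qed

section \<open>Growth of the partial sums across blocks\<close>

lemma S_mono: "n \<le> n' \<Longrightarrow> S n \<le> S n'"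
  unfolding S_def
  by (intro sum_mono2) (auto intro: order_trans[OF zero_le_one a_ge_1])

lemma S_ge: "S n \<ge> real n"
proof -
  have "(\<Sum>k=1..n. 1) \<le> S n" unfolding S_def by (intro sum_mono a_ge_1) simp
  then show ?thesis by simp
qed

lemma S_add: "S (n + k) = S n + (\<Sum>i\<in>{n<..n+k}. a i)"
proof -
  have "{1..n + k} = {1..n} \<union> {n<..n+k}" by auto
  moreover have "{1..n} \<inter> {n<..n+k} = {}" by auto
  ultimately show ?thesis unfolding S_def by (simp only: sum.union_disjoint finite_atLeastAtMost finite_greaterThanAtMost)
qed

text \<open>The solution of \<open>q * q + M = M * q\<close>, which makes the induction step in
  \<open>sum_J_le\<close> close with equality. Since it is also at least \<open>q\<close>, it bounds
  the summands at ones as well.\<close>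

definition M :: real where "M = q * q / (q - 1)"

lemma M_ge_q: "M \<ge> q" and M_ge_1: "M \<ge> 1"
proof -
  show "M \<ge> q" using q_gt_1 by (simp add: M_def field_simps)
  then show "M \<ge> 1" using q_gt_1 by simp
qed

lemma sum_J_le:
  assumes "r \<le> l (Suc j)"
  shows "(\<Sum>i\<in>{s (Suc j) - r<..s (Suc j)}. a i) \<le> M * q ^ r"
  using assms
proof (induction r)
  case 0
  then show ?case using M_ge_1 by simp
next
  case (Suc r)
  have le: "Suc r \<le> s (Suc j)" using Suc.prems by (simp add: s_Suc)
  have "{s (Suc j) - Suc r<..s (Suc j)} = insert (s (Suc j) + 1 - Suc r) {s (Suc j) - r<..s (Suc j)}"
    using le by auto
  moreover have "s (Suc j) + 1 - Suc r \<notin> {s (Suc j) - r<..s (Suc j)}" by auto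
  ultimately have "(\<Sum>i\<in>{s (Suc j) - Suc r<..s (Suc j)}. a i) =
      a (s (Suc j) + 1 - Suc r) + (\<Sum>i\<in>{s (Suc j) - r<..s (Suc j)}. a i)"
    by simp
  also have "\<dots> \<le> q * q ^ Suc r + M * q ^ r"
    using Suc a_zero_run_bounds(2)[OF Suc.prems] by simp
  also have "\<dots> = M * q ^ Suc r" using q_gt_1 by (simp add: M_def field_simps)
  finally show ?case .
qed

lemma S_s_le: "S (s (Suc j)) \<le> S (t j) + M * q ^ l (Suc j)"
  using S_add[of "t j" "l (Suc j)"] sum_J_le[of "l (Suc j)" j] by (simp add: s_Suc)

lemma S_t_le: "S (t (Suc j)) \<le> S (s (Suc j)) + M * m (Suc j)"
proof -
  have "(\<Sum>i\<in>{s (Suc j)<..s (Suc j) + m (Suc j)}. a i) \<le> (\<Sum>i\<in>{s (Suc j)<..s (Suc j) + m (Suc j)}. M)"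
    by (intro sum_mono order_trans[OF a_one(2)[of _ "Suc j"] M_ge_q]) (simp add: mem_K t_Suc)
  then show ?thesis by (simp add: t_Suc S_add mult.commute)
qed

text \<open>The first zero of a block alone contributes the full order of the block. Lower bounds by
  \<open>P\<close> therefore hold from the first position on.\<close>

lemma S_after_t: "S (t j + 1) \<ge> S (t j) + q ^ l (Suc j)"
proof -
  have "{t j<..t j + 1} = {t j + 1}" by auto
  then show ?thesis
    using a_zero_run_bounds(1)[of "l (Suc j)" j] S_add[of "t j" 1] by (simp add: s_Suc)
qed

lemma P_Suc: "P (Suc j) = Q j + q ^ l (Suc j)"
  by (simp add: P_def Q_def powr_q)

lemma Q_Suc: "Q (Suc j) = P (Suc j) + m (Suc j)"
  by (simp add: P_def Q_def)

lemma D_Suc: "D (Suc j) = F j + l (Suc j)"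
  by (simp add: D_def F_def)

lemma F_Suc: "F (Suc j) = D (Suc j) + m (Suc j)"
  by (simp add: D_def F_def)

lemma t_eq: "real (t j) = m 0 + F j"
  by (induction j) (simp_all add: F_def tpos.simps(2))

lemma s_eq: "real (s (Suc j)) = m 0 + D (Suc j)"
  by (simp add: s_Suc t_eq D_Suc)

text \<open>Induction over pairs of blocks: the zeros add a term of order
  \<open>q ^ l (Suc j)\<close>, the ones a term of order \<open>m (Suc j)\<close>, and these are the
  increments of \<open>Q\<close>. The summand \<open>m 0\<close> pays for the initial ones, which
  \<open>Q\<close> does not count.\<close>

lemma S_t_bounds: "Q j \<le> S (t j)" "S (t j) \<le> M * (m 0 + Q j)"
proof (induction j)
  case 0
  have "(\<Sum>k=1..m 0. a k) \<le> (\<Sum>k=1..m 0. M)"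
    by (intro sum_mono order_trans[OF a_one(2)[of _ 0] M_ge_q]) (simp add: mem_K spos_def)
  then have "S (t 0) \<le> M * m 0" by (simp add: S_def mult.commute)
  then show "S (t 0) \<le> M * (m 0 + Q 0)" by (simp add: Q_def)
  show "Q 0 \<le> S (t 0)" using S_ge[of "t 0"] by (simp add: Q_def)
next
  case (Suc j)
  have "(\<Sum>i\<in>{s (Suc j)<..s (Suc j) + m (Suc j)}. 1) \<le> (\<Sum>i\<in>{s (Suc j)<..s (Suc j) + m (Suc j)}. a i)"
    by (intro sum_mono a_ge_1) auto
  then have "S (s (Suc j)) + m (Suc j) \<le> S (t (Suc j))" by (simp add: t_Suc S_add)
  moreover have "S (t j + 1) \<le> S (s (Suc j))"
    using lengths_pos(1)[of "Suc j"] by (intro S_mono) (simp add: s_Suc)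
  ultimately show "Q (Suc j) \<le> S (t (Suc j))"
    using S_after_t[of j] Suc by (simp add: P_Suc Q_Suc)
  show "S (t (Suc j)) \<le> M * (m 0 + Q (Suc j))"
    using S_t_le[of j] S_s_le[of j] Suc by (simp add: P_Suc Q_Suc algebra_simps)
qed

lemma S_ge_P: "t j < n \<Longrightarrow> P (Suc j) \<le> S n"
  using S_mono[of "t j + 1" n] S_after_t[of j] S_t_bounds(1)[of j] by (simp add: P_Suc)

lemma S_s_bound: "S (s (Suc j)) \<le> M * (m 0 + P (Suc j))"
  using S_s_le[of j] S_t_bounds(2)[of j] by (simp add: P_Suc algebra_simps)

lemma Q_ge_0: "Q j \<ge> 0"
  unfolding Q_def by (intro add_nonneg_nonneg sum_nonneg) auto

lemma P_ge_1: "P (Suc j) \<ge> 1"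
proof -
  have "1 \<le> q ^ l (Suc j)" using q_gt_1 by (simp add: one_le_power)
  then show ?thesis using Q_ge_0[of j] by (simp add: P_Suc)
qed

lemma Q_ge_1: "Q (Suc j) \<ge> 1"
  using P_ge_1[of j] by (simp add: Q_Suc)

lemma D_ge_1: "D (Suc j) \<ge> 1"
proof -
  have "F j \<ge> 0" unfolding F_def by (intro add_nonneg_nonneg sum_nonneg) auto
  then show ?thesis using lengths_pos(1)[of "Suc j"] by (simp add: D_Suc)
qed

lemma F_ge_1: "F (Suc j) \<ge> 1"
  using D_ge_1[of j] by (simp add: F_Suc)

text \<open>Exponentials dominate lengths: \<open>1 + n * ln q \<le> q ^ n\<close>. The extra 1 in
  the factor keeps it at least 1, as the sums of \<open>m\<close> on both sides require.\<close>

lemma D_le_P: "D j \<le> (1 + 1 / ln q) * P j"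
proof -
  have lnq: "ln q > 0" using q_gt_1 by simp
  have "real n \<le> (1 + 1 / ln q) * 2 powr (p * real n)" for n
  proof -
    have "1 + real n * ln q \<le> exp (real n * ln q)" by (rule exp_ge_add_one_self)
    also have "\<dots> = q ^ n" using q_gt_1 by (simp add: exp_of_nat_mult)
    finally have "real n \<le> 1 / ln q * q ^ n" using lnq by (simp add: field_simps)
    moreover have "0 \<le> q ^ n" using q_gt_1 by simp
    ultimately show ?thesis by (simp add: powr_q algebra_simps)
  qed
  then have "(\<Sum>u=1..j. real (l u)) \<le> (1 + 1 / ln q) * (\<Sum>u=1..j. 2 powr (p * real (l u)))"
    by (simp add: sum_distrib_left sum_mono)
  moreover have "(\<Sum>u=1..j-1. real (m u)) \<le> (1 + 1 / ln q) * (\<Sum>u=1..j-1. real (m u))"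
    using lnq mult_right_mono[of 1 "1 + 1 / ln q" "\<Sum>u=1..j-1. real (m u)"] by (simp add: sum_nonneg)
  ultimately show ?thesis by (simp add: D_def P_def distrib_left)
qed

section \<open>Values of \<open>Phi2\<close> and \<open>Psi2\<close> on the blocks\<close>

lemma block_index_eq: "n \<ge> 1 \<Longrightarrow> n \<in> Jpos x j \<union> Kpos x j \<Longrightarrow> block_index x n = j"
  unfolding block_index_def using block_index_unique[OF x_nondyadic] by (intro the1_equality)

lemma J_ge_1: "n \<in> Jpos x j \<Longrightarrow> n \<ge> 1"
  by (cases j) (auto simp: Jpos_def zero_block_def)

lemma K_ge_1: "n \<in> Kpos x j \<Longrightarrow> n \<ge> 1"
  by (auto simp: Kpos_def one_block_def)

lemma late_block:
  assumes "j \<ge> 2" "n \<in> Jpos x j \<union> Kpos x j"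
  shows "n \<notin> Kpos x 0 \<union> Jpos x 1 \<union> Kpos x 1" "block_index x n = j"
proof -
  have n: "n \<ge> 1" using assms J_ge_1 K_ge_1 by auto
  show j: "block_index x n = j" using block_index_eq[OF n assms(2)] .
  show "n \<notin> Kpos x 0 \<union> Jpos x 1 \<union> Kpos x 1"
    using block_index_eq[OF n, of 0] block_index_eq[OF n, of 1] assms(1) j by auto
qed

text \<open>Writing the index as \<open>Suc (Suc i)\<close> encodes \<open>j \<ge> 2\<close> and
  lets \<open>j - 1\<close> simplify to \<open>Suc i\<close>.\<close>

lemma on_J:
  assumes "n \<in> Jpos x (Suc (Suc i))"
  shows "Phi2 p x n = P (Suc (Suc i)) / D (Suc (Suc i))"
    and "Psi2 p x n = P (Suc (Suc i)) / F (Suc i)"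
  using late_block[of "Suc (Suc i)" n] assms
  by (simp_all add: Phi2_def Psi2_def Phi1_def Psi1_def P_def D_def F_def Let_def)

lemma on_K:
  assumes "n \<in> Kpos x (Suc (Suc i))"
  shows "Phi2 p x n = P (Suc (Suc i)) / F (Suc (Suc i))"
    and "Psi2 p x n = Q (Suc (Suc i)) / D (Suc (Suc i))"
proof -
  have "n \<notin> Jpos x (Suc (Suc i))" using assms by (auto simp: mem_J mem_K)
  then show "Phi2 p x n = P (Suc (Suc i)) / F (Suc (Suc i))"
    "Psi2 p x n = Q (Suc (Suc i)) / D (Suc (Suc i))"
    using late_block[of "Suc (Suc i)" n] assms
    by (simp_all add: Phi2_def Psi2_def Phi1_def Psi1_def P_def Q_def D_def F_def Let_def)
qed

lemma block_cases:
  assumes "n \<ge> 1"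
  obtains (initial) "n \<le> t 1" "Phi2 p x n = 1" "Psi2 p x n = 1"
    | (J) i where "n \<in> Jpos x (Suc (Suc i))"
    | (K) i where "n \<in> Kpos x (Suc (Suc i))"
proof -
  obtain j where j: "n \<in> Jpos x j \<union> Kpos x j" using in_blocks[OF assms] by blast
  show ?thesis
  proof (cases "j \<ge> 2")
    case True
    then obtain i where "j = Suc (Suc i)" by (metis add_2_eq_Suc le_Suc_ex)
    then show ?thesis using j that(2,3) by blast
  next
    case False
    then have "j = 0 \<or> j = 1" by auto
    then have n: "n \<in> Kpos x 0 \<union> Jpos x 1 \<union> Kpos x 1"
      using j by (auto simp: Jpos_def zero_block_def)
    then have "n \<le> t 1" by (auto simp: mem_K mem_J t_Suc s_Suc)
    then show ?thesis using n that(1) by (simp add: Phi2_def Psi2_def)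
  qed
qed

section \<open>The general estimate of the averages\<close>

lemma average_eq: "birkhoff_average p x n = S n / real n"
  by (simp add: birkhoff_average_def S_def a_def orbit_def)

text \<open>The factor that swallows the offset \<open>m 0\<close> wherever it is added to a
  quantity that is at least 1; see \<open>absorb\<close>.\<close>

definition R :: real where "R = 1 + real (m 0)"

lemma R_ge_1: "R \<ge> 1"
  by (simp add: R_def)

lemma absorb: "y \<ge> 1 \<Longrightarrow> real (m 0) + y \<le> R * y"
  using mult_left_mono[of 1 y "real (m 0)"] by (simp add: R_def algebra_simps)

lemma S_J_le: "n \<in> Jpos x (Suc j) \<Longrightarrow> S n \<le> M * R * P (Suc j)"
proof -
  assume "n \<in> Jpos x (Suc j)"
  then have "S n \<le> S (s (Suc j))" by (intro S_mono) (simp add: mem_J)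
  also have "\<dots> \<le> M * (m 0 + P (Suc j))" by (rule S_s_bound)
  also have "\<dots> \<le> M * (R * P (Suc j))"
    using absorb[OF P_ge_1[of j]] M_ge_1 by (intro mult_left_mono) auto
  finally show ?thesis by (simp add: mult.assoc)
qed

lemma S_K_le: "n \<in> Kpos x (Suc j) \<Longrightarrow> S n \<le> M * R * Q (Suc j)"
proof -
  assume "n \<in> Kpos x (Suc j)"
  then have "S n \<le> S (t (Suc j))" by (intro S_mono) (simp add: mem_K)
  also have "\<dots> \<le> M * (m 0 + Q (Suc j))" by (rule S_t_bounds(2))
  also have "\<dots> \<le> M * (R * Q (Suc j))"
    using absorb[OF Q_ge_1[of j]] M_ge_1 by (intro mult_left_mono) auto
  finally show ?thesis by (simp add: mult.assoc)
qed

lemma s_lt_K: "n \<in> Kpos x (Suc j) \<Longrightarrow> D (Suc j) \<le> real n"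
  using s_eq[of j] by (simp add: mem_K)

lemma quotient_lower:
  assumes "n \<ge> 1" "P j \<le> S n" "real n \<le> r * d" "P j \<ge> 0" "d \<ge> 1" "r > 0"
  shows "1 / r * (P j / d) \<le> birkhoff_average p x n"
proof -
  have "P j / (r * d) \<le> S n / real n"
    using assms by (intro frac_le) auto
  then show ?thesis by (simp add: average_eq)
qed

text \<open>From the first position of the zeros on, \<open>S n\<close> is at least the numerator
  \<open>P\<close> of \<open>Phi2\<close>, and up to the end of the current block \<open>n\<close>
  is at most \<open>R\<close> times its denominator.\<close>

lemma lower_bound:
  assumes "n \<ge> 1"
  shows "1 / R * Phi2 p x n \<le> birkhoff_average p x n"
  using assms
proof (cases rule: block_cases)
  case initial
  have "1 \<le> birkhoff_average p x n"
    using S_ge[of n] assms by (simp add: average_eq field_simps)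
  moreover have "1 / R \<le> 1" using R_ge_1 by simp
  ultimately show ?thesis using initial by simp
next
  case (J i)
  have "real n \<le> R * D (Suc (Suc i))"
    using J absorb[OF D_ge_1[of "Suc i"]] s_eq[of "Suc i"] by (simp add: mem_J)
  then show ?thesis
    unfolding on_J[OF J] using J S_ge_P P_ge_1[of "Suc i"] D_ge_1[of "Suc i"] R_ge_1 assms
    by (intro quotient_lower) (auto simp: mem_J)
next
  case (K i)
  have "real n \<le> R * F (Suc (Suc i))"
    using K absorb[OF F_ge_1[of "Suc i"]] t_eq[of "Suc (Suc i)"] by (simp add: mem_K)
  then show ?thesis
    unfolding on_K[OF K] using K S_ge_P P_ge_1[of "Suc i"] F_ge_1[of "Suc i"] R_ge_1 assms
    by (intro quotient_lower) (auto simp: mem_K s_Suc)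
qed

text \<open>Dually, the numerator of \<open>Psi2\<close> bounds the sum up to the end of the current
  block, and its denominator is at most any position in that block. The term \<open>S (t 1)\<close>
  covers the initial blocks, where \<open>Psi2\<close> is 1.\<close>

lemma upper_bound:
  assumes "n \<ge> 1"
  shows "birkhoff_average p x n \<le> (M * R + S (t 1)) * Psi2 p x n"
proof -
  have MR: "M * R \<ge> 0" and S1: "S (t 1) \<ge> 0"
    using M_ge_1 R_ge_1 S_ge[of "t 1"] by simp_all
  have quot: "S n / real n \<le> (M * R + S (t 1)) * (y / d)"
    if "S n \<le> M * R * y" "d \<le> real n" "y \<ge> 0" "d > 0" for y d
  proof -
    have "S n / real n \<le> (M * R * y) / d"
      using that S_ge[of n] by (intro frac_le) auto
    also have "\<dots> = M * R * (y / d)" by simp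
    also have "\<dots> \<le> (M * R + S (t 1)) * (y / d)"
      using that S1 by (intro mult_right_mono) auto
    finally show ?thesis .
  qed
  show ?thesis
    using assms
  proof (cases rule: block_cases)
    case initial
    have "S n / real n \<le> S n / 1"
      using assms S_ge[of n] by (intro divide_left_mono) auto
    then show ?thesis using S_mono[OF initial(1)] initial(3) MR by (simp add: average_eq)
  next
    case (J i)
    have "F (Suc i) \<le> real n" using J t_eq[of "Suc i"] by (simp add: mem_J)
    then show ?thesis
      unfolding on_J[OF J] average_eq
      using S_J_le[OF J] P_ge_1[of "Suc i"] F_ge_1[of i] by (intro quot) auto
  next
    case (K i)
    then show ?thesis
      unfolding on_K[OF K] average_eq
      using S_K_le[OF K] s_lt_K[OF K] Q_ge_1[of "Suc i"] D_ge_1[of "Suc i"] by (intro quot) auto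
  qed
qed

section \<open>Regularity and its equivalents\<close>

lemma regularI:
  assumes "\<And>i. real (l (Suc (Suc i))) \<le> c * F (Suc i)"
    and "\<And>i. real (m (Suc (Suc i))) \<le> c' * D (Suc (Suc i))"
  shows "regular_decomposition x"
proof -
  \<comment> \<open>The 1 guarantees a positive constant without sign assumptions on
    \<open>c\<close> and \<open>c'\<close>.\<close>
  define C where "C = max 1 (max c c')"
  have "max (real (l j) / ((\<Sum>u=1..j-1. real (l u)) + (\<Sum>u=1..j-1. real (m u))))
      (real (m j) / ((\<Sum>u=1..j. real (l u)) + (\<Sum>u=1..j-1. real (m u)))) \<le> C"
    if j2: "j \<ge> 2" for j
  proof -
    obtain i where j: "j = Suc (Suc i)" using j2 by (metis add_2_eq_Suc le_Suc_ex)
    have "c * F (Suc i) \<le> C * F (Suc i)" "c' * D j \<le> C * D j"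
      using F_ge_1[of i] D_ge_1[of "Suc i"] by (auto simp: C_def j intro!: mult_right_mono)
    then have "l j \<le> C * F (Suc i)" "m j \<le> C * D j"
      using assms[of i] unfolding j by linarith+
    then have "l j / F (Suc i) \<le> C" "m j / D j \<le> C"
      using F_ge_1[of i] D_ge_1[of "Suc i"] by (simp_all add: j pos_divide_le_eq)
    then show ?thesis by (simp add: F_def D_def j)
  qed
  moreover have "C > 0" by (simp add: C_def)
  ultimately show ?thesis unfolding regular_decomposition_def by blast
qed

lemma regularE:
  assumes "regular_decomposition x"
  obtains C where "C > 0" "\<And>i. real (l (Suc (Suc i))) \<le> C * F (Suc i)"
    "\<And>i. real (m (Suc (Suc i))) \<le> C * D (Suc (Suc i))"
proof -
  obtain C where C: "C > 0" and b: "\<And>j. j \<ge> 2 \<Longrightarrow>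
      max (real (l j) / ((\<Sum>u=1..j-1. real (l u)) + (\<Sum>u=1..j-1. real (m u))))
      (real (m j) / ((\<Sum>u=1..j. real (l u)) + (\<Sum>u=1..j-1. real (m u)))) \<le> C"
    using assms unfolding regular_decomposition_def by blast
  have "l (Suc (Suc i)) / F (Suc i) \<le> C" "m (Suc (Suc i)) / D (Suc (Suc i)) \<le> C" for i
    using b[of "Suc (Suc i)"] by (simp_all add: F_def D_def)
  then show ?thesis
    using that[OF C] F_ge_1 D_ge_1 by (simp add: pos_divide_le_eq order_less_le_trans[OF zero_less_one])
qed

text \<open>On zeros \<open>Psi2 / Phi2\<close> is \<open>D / F\<close> with \<open>F\<close> taken
  one index earlier, at most \<open>1 + C\<close>. On ones it is \<open>(Q / P) * (F / D)\<close>,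
  where \<open>F / D\<close> is at most \<open>1 + C\<close> and \<open>Q / P\<close> at most
  \<open>1 + C * c\<close> by \<open>D_le_P\<close>. The product of the two bounds serves
  everywhere.\<close>

lemma regular_imp_comparable:
  assumes "regular_decomposition x"
  shows "\<exists>a>0. \<forall>n\<ge>1. Psi2 p x n \<le> a * Phi2 p x n"
proof -
  obtain C where C: "C > 0" and lC: "\<And>i. real (l (Suc (Suc i))) \<le> C * F (Suc i)"
    and mC: "\<And>i. real (m (Suc (Suc i))) \<le> C * D (Suc (Suc i))"
    using regularE[OF assms] by blast
  define c where "c = 1 + 1 / ln q"
  have c: "c \<ge> 1" using q_gt_1 by (simp add: c_def)
  have Cc: "1 \<le> 1 + C * c" using C c by simp
  have le: "1 + C \<le> (1 + C * c) * (1 + C)"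
    using mult_right_mono[OF Cc, of "1 + C"] C by simp
  then have le1: "1 \<le> (1 + C * c) * (1 + C)" using C by linarith
  have "Psi2 p x n \<le> (1 + C * c) * (1 + C) * Phi2 p x n" if n: "n \<ge> 1" for n
    using n
  proof (cases rule: block_cases)
    case initial
    then show ?thesis using le1 by simp
  next
    case (J i)
    have F: "F (Suc i) \<ge> 1" and D: "D (Suc (Suc i)) \<ge> 1" by (rule F_ge_1 D_ge_1)+
    have "D (Suc (Suc i)) \<le> (1 + C) * F (Suc i)"
      using lC[of i] by (simp add: D_Suc[of "Suc i"] algebra_simps)
    also have "\<dots> \<le> (1 + C * c) * (1 + C) * F (Suc i)"
      using le F by (intro mult_right_mono) auto
    finally have "P (Suc (Suc i)) * D (Suc (Suc i)) \<le>
        P (Suc (Suc i)) * ((1 + C * c) * (1 + C) * F (Suc i))"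
      using P_ge_1[of "Suc i"] by (intro mult_left_mono) auto
    then show ?thesis unfolding on_J[OF J] using F D by (intro divide_le_scaled) (auto simp: mult_ac)
  next
    case (K i)
    have F: "F (Suc (Suc i)) \<ge> 1" and D: "D (Suc (Suc i)) \<ge> 1" by (rule F_ge_1 D_ge_1)+
    have "m (Suc (Suc i)) \<le> C * (c * P (Suc (Suc i)))"
      using mC[of i] mult_left_mono[OF D_le_P[of "Suc (Suc i)", folded c_def] less_imp_le[OF C]]
      by (rule order_trans)
    then have QP: "Q (Suc (Suc i)) \<le> (1 + C * c) * P (Suc (Suc i))"
      by (simp add: Q_Suc[of "Suc i"] algebra_simps)
    have FD: "F (Suc (Suc i)) \<le> (1 + C) * D (Suc (Suc i))"
      using mC[of i] by (simp add: F_Suc[of "Suc i"] algebra_simps)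
    have "Q (Suc (Suc i)) * F (Suc (Suc i)) \<le>
        ((1 + C * c) * P (Suc (Suc i))) * ((1 + C) * D (Suc (Suc i)))"
      using QP FD F Q_ge_1[of "Suc i"] by (intro mult_mono) auto
    then show ?thesis unfolding on_K[OF K] using F D by (intro divide_le_scaled) (auto simp: mult_ac)
  qed
  then show ?thesis using le1 by (intro exI[of _ "(1 + C * c) * (1 + C)"]) auto
qed

text \<open>\<^term>\<open>Phi2 p x\<close> is constant on each block, so the averages are tested at the first
  position of the block, where they are of the largest order.\<close>

lemma Phi2_bound_imp_regular:
  assumes b: "\<And>n. n \<ge> 1 \<Longrightarrow> birkhoff_average p x n \<le> b * Phi2 p x n" "b > 0"
  shows "regular_decomposition x"
proof (rule regularI)
  \<comment> \<open>Here \<open>d\<close> and \<open>d'\<close> are the denominators at the ends of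
    the preceding and of the current block, and \<open>n\<close> is the first position of the
    current one. The sum has already reached \<open>P (Suc j)\<close>, so \<open>P (Suc j)\<close>
    cancels and \<open>d'\<close> is compared with \<open>n\<close>.\<close>
  have main: "d' \<le> b * (R * d + d)"
    if n: "n \<ge> 1" "P (Suc j) \<le> S n" "real n \<le> m 0 + d + 1" "Phi2 p x n = P (Suc j) / d'"
      "d \<ge> 1" "d' \<ge> 1" for n j and d d' :: real
  proof -
    have "real n \<le> R * d + d" using n absorb[of d] by simp
    moreover have "P (Suc j) / real n \<le> S n / real n" using n by (intro divide_right_mono) auto
    then have "P (Suc j) / real n \<le> b * (P (Suc j) / d')"
      using b(1)[OF n(1)] n(4) by (simp add: average_eq)
    then have "d' \<le> b * real n"
      using n P_ge_1[of j] by (simp add: field_simps)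
    ultimately show ?thesis using b(2) by (meson mult_left_mono less_imp_le order_trans)
  qed
  show "real (l (Suc (Suc i))) \<le> (b * (R + 1)) * F (Suc i)" for i
  proof -
    have mem: "t (Suc i) + 1 \<in> Jpos x (Suc (Suc i))"
      using lengths_pos(1)[of "Suc (Suc i)"] by (simp add: mem_J s_Suc[of "Suc i"])
    have "D (Suc (Suc i)) \<le> b * (R * F (Suc i) + F (Suc i))"
      using S_ge_P[of "Suc i"] on_J(1)[OF mem] by (intro main) (auto simp: t_eq F_ge_1 D_ge_1)
    then show ?thesis using F_ge_1[of i] by (simp add: D_Suc[of "Suc i"] algebra_simps)
  qed
  show "real (m (Suc (Suc i))) \<le> (b * (R + 1)) * D (Suc (Suc i))" for i
  proof -
    have "F (Suc (Suc i)) \<le> b * (R * D (Suc (Suc i)) + D (Suc (Suc i)))"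
    proof (rule main[OF _ _ _ on_K(1)[OF first_one]])
      show "P (Suc (Suc i)) \<le> S (s (Suc (Suc i)) + 1)"
        by (rule S_ge_P) (simp add: s_Suc[of "Suc i"])
    qed (simp_all add: s_eq F_ge_1 D_ge_1)
    then show ?thesis using D_ge_1[of "Suc i"] by (simp add: F_Suc[of "Suc i"] algebra_simps)
  qed
qed

text \<open>Dually, the averages are of the smallest order at the last position of a block.\<close>

lemma Psi2_bound_imp_regular:
  assumes c: "\<And>n. n \<ge> 1 \<Longrightarrow> c * Psi2 p x n \<le> birkhoff_average p x n" "c > 0"
  shows "regular_decomposition x"
proof (rule regularI)
  \<comment> \<open>Now \<open>n\<close> is the last position of a block and \<open>y\<close> the
    numerator of \<open>Psi2\<close>, which cancels against the upper bound for \<open>S n\<close>.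
    What remains compares \<open>n\<close>, hence \<open>d'\<close>, with the denominator
    \<open>d\<close> of the preceding block.\<close>
  have main: "d' \<le> M * R / c * d"
    if n: "n \<ge> 1" "S n \<le> M * R * y" "d' \<le> real n" "Psi2 p x n = y / d" "y \<ge> 1" "d \<ge> 1" for n and y d d' :: real
  proof -
    have "S n / real n \<le> M * R * y / real n" using n by (intro divide_right_mono) auto
    then have "c * (y / d) \<le> M * R * y / real n"
      using c(1)[OF n(1)] n(4) by (simp add: average_eq)
    then have "c * real n \<le> M * R * d"
      using n by (simp add: field_simps)
    then have "real n \<le> M * R / c * d" using c(2) by (simp add: field_simps)
    then show ?thesis using n by simp
  qed
  show "real (l (Suc (Suc i))) \<le> (M * R / c) * F (Suc i)" for i
  proof -
    have mem: "s (Suc (Suc i)) \<in> Jpos x (Suc (Suc i))"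
      using lengths_pos(1)[of "Suc (Suc i)"] by (simp add: mem_J s_Suc[of "Suc i"])
    have "D (Suc (Suc i)) \<le> M * R / c * F (Suc i)"
      by (rule main[OF J_ge_1[OF mem] S_J_le[OF mem] _ on_J(2)[OF mem]]) (simp_all add: s_eq P_ge_1 F_ge_1)
    then show ?thesis using F_ge_1[of i] by (simp add: D_Suc[of "Suc i"])
  qed
  show "real (m (Suc (Suc i))) \<le> (M * R / c) * D (Suc (Suc i))" for i
  proof -
    have mem: "t (Suc (Suc i)) \<in> Kpos x (Suc (Suc i))"
      using lengths_pos(2)[of "Suc (Suc i)"] by (simp add: mem_K t_Suc[of "Suc i"])
    have "F (Suc (Suc i)) \<le> M * R / c * D (Suc (Suc i))"
      by (rule main[OF K_ge_1[OF mem] S_K_le[OF mem] _ on_K(2)[OF mem]])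
        (simp_all add: t_eq Q_ge_1 D_ge_1)
    then show ?thesis using D_ge_1[of "Suc i"] by (simp add: F_Suc[of "Suc i"])
  qed
qed

lemma average_bounds:
  "\<exists>b1>0. \<exists>b2>0. \<forall>n\<ge>1.
     b1 * Phi2 p x n \<le> birkhoff_average p x n \<and> birkhoff_average p x n \<le> b2 * Psi2 p x n"
proof -
  have "1 / R > 0" "M * R + S (t 1) > 0"
    using R_ge_1 M_ge_1 S_ge[of "t 1"] by (auto intro!: add_pos_nonneg mult_pos_pos)
  then show ?thesis using lower_bound upper_bound by blast
qed

text \<open>Chaining \<open>average_bounds\<close> with \<open>Psi2 \<le> a * Phi2\<close> replaces
  one function by the other, at the price of the factor \<open>a\<close> above or
  \<open>1 / a\<close> below.\<close>

lemma comparable_imp: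
  assumes "\<exists>a>0. \<forall>n\<ge>1. Psi2 p x n \<le> a * Phi2 p x n"
  shows "\<exists>b1>0. \<exists>b2>0. \<forall>n\<ge>1.
     b1 * Phi2 p x n \<le> birkhoff_average p x n \<and> birkhoff_average p x n \<le> b2 * Phi2 p x n"
    and "\<exists>c1>0. \<exists>c2>0. \<forall>n\<ge>1.
     c1 * Psi2 p x n \<le> birkhoff_average p x n \<and> birkhoff_average p x n \<le> c2 * Psi2 p x n"
proof -
  obtain a where a: "a > 0" "\<And>n. n \<ge> 1 \<Longrightarrow> Psi2 p x n \<le> a * Phi2 p x n" using assms by blast
  obtain b1 b2 where b: "b1 > 0" "b2 > 0"
    and lo: "\<And>n. n \<ge> 1 \<Longrightarrow> b1 * Phi2 p x n \<le> birkhoff_average p x n"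
    and up: "\<And>n. n \<ge> 1 \<Longrightarrow> birkhoff_average p x n \<le> b2 * Psi2 p x n"
    using average_bounds by blast
  have "birkhoff_average p x n \<le> b2 * a * Phi2 p x n" if "n \<ge> 1" for n
    using order_trans[OF up[OF that] mult_left_mono[OF a(2)[OF that] less_imp_le[OF b(2)]]]
    by (simp add: mult.assoc)
  then show "\<exists>b1>0. \<exists>b2>0. \<forall>n\<ge>1.
     b1 * Phi2 p x n \<le> birkhoff_average p x n \<and> birkhoff_average p x n \<le> b2 * Phi2 p x n"
    using lo a b by (intro exI[of _ b1] conjI exI[of _ "b2 * a"]) auto
  have "b1 / a * Psi2 p x n \<le> birkhoff_average p x n" if "n \<ge> 1" for n
  proof -
    have "b1 / a * Psi2 p x n \<le> b1 / a * (a * Phi2 p x n)"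
      using a(2)[OF that] a(1) b by (intro mult_left_mono) auto
    then show ?thesis using lo[OF that] a(1) by simp
  qed
  then show "\<exists>c1>0. \<exists>c2>0. \<forall>n\<ge>1.
     c1 * Psi2 p x n \<le> birkhoff_average p x n \<and> birkhoff_average p x n \<le> c2 * Psi2 p x n"
    using up a b by (intro exI[of _ "b1 / a"] conjI exI[of _ b2]) auto
qed

end

theorem theorem3p9:
  fixes p x :: real
  assumes "p > 0" and "x \<in> nondyadic"
  shows
    "(\<exists>b1>0. \<exists>b2>0. \<forall>n\<ge>1.
        b1 * Phi2 p x n \<le> birkhoff_average p x n \<and> birkhoff_average p x n \<le> b2 * Psi2 p x n)
     \<and>
     (let
        A = regular_decomposition x;
        B = (\<exists>a>0. \<forall>n\<ge>1. Psi2 p x n \<le> a * Phi2 p x n);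
        C = (\<exists>b1>0. \<exists>b2>0. \<forall>n\<ge>1.
               b1 * Phi2 p x n \<le> birkhoff_average p x n \<and> birkhoff_average p x n \<le> b2 * Phi2 p x n);
        D = (\<exists>c1>0. \<exists>c2>0. \<forall>n\<ge>1.
               c1 * Psi2 p x n \<le> birkhoff_average p x n \<and> birkhoff_average p x n \<le> c2 * Psi2 p x n)
      in (A \<longleftrightarrow> B) \<and> (B \<longleftrightarrow> C) \<and> (C \<longleftrightarrow> D))"
proof -
  interpret doubling_orbit p x by unfold_locales (use assms in auto)
  let ?avg = "birkhoff_average p x"
  let ?B = "\<exists>a>0. \<forall>n\<ge>1. Psi2 p x n \<le> a * Phi2 p x n"
  let ?C = "\<exists>b1>0. \<exists>b2>0. \<forall>n\<ge>1. b1 * Phi2 p x n \<le> ?avg n \<and> ?avg n \<le> b2 * Phi2 p x n"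
  let ?D = "\<exists>c1>0. \<exists>c2>0. \<forall>n\<ge>1. c1 * Psi2 p x n \<le> ?avg n \<and> ?avg n \<le> c2 * Psi2 p x n"
  have CA: "regular_decomposition x" if ?C
    using that Phi2_bound_imp_regular by blast
  have DA: "regular_decomposition x" if ?D
    using that Psi2_bound_imp_regular by blast
  \<comment> \<open>Regularity gives \<open>?B\<close>, which gives both \<open>?C\<close> and
    \<open>?D\<close>, and each of these returns to regularity; the rest is propositional.\<close>
  have "regular_decomposition x \<longleftrightarrow> ?B" "?B \<longleftrightarrow> ?C" "?C \<longleftrightarrow> ?D"
    using regular_imp_comparable comparable_imp CA DA by argo+
  then show ?thesis
    unfolding Let_def using average_bounds by (intro conjI)
qed

end
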